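(* (Ramanujan's cubic transformation.) For $0<k \leq 1$, $$F\left(\frac13,\frac23;1;1-k^3\right)=\frac{3}{1+2k}\,F\left(\frac13,\frac23;1;\left(\frac{1-k}{1+2k}\right)^3\right).$$
   Context: For $|x|<1$, $F(a,b;c;x):=\sum_{n=0}^\infty \frac{(a)_n(b)_n}{(c)_n}\frac{x^n}{n!}$ is the Gaussian hypergeometric series, where $(a)_0:=1$ and $(a)_n:=a(a+1)\cdots(a+n-1)$ for $n\ge1$. *)

theory Defs
  imports Complex_Main
begin

text \<open>The Gaussian hypergeometric series. As \<^term>\<open>suminf\<close> is total, the definition is meaningful
  only where the series converges, in particular for \<open>norm x < 1\<close> with \<open>c\<close> not a nonpositive integer.\<close>

definition hypergeo_2F1 ::
    "'a::{real_normed_field,banach} \<Rightarrow> 'a \<Rightarrow> 'a \<Rightarrow> 'a \<Rightarrow> 'a" where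
  "hypergeo_2F1 a b c x =
     (\<Sum>n. pochhammer a n * pochhammer b n / pochhammer c n * (x ^ n / fact n))"

end

theory Submission imports Defs "HOL-Real_Asymp.Real_Asymp"
begin

text \<open>With \<open>F = F(1/3, 2/3; 1; _)\<close>, both sides are solutions on \<open>(0, 1]\<close> of the
  Sturm--Liouville equation \<open>(p y')' = 2 k\<^sup>2 y\<close> with \<open>p = k (1 - k\<^sup>3)\<close>. Their Wronskian, multiplied by
  \<open>p\<close>, is constant, and it vanishes at \<open>k = 1\<close>, where \<open>p\<close> does. So the two sides are proportional,
  and both equal \<open>1\<close> at \<open>k = 1\<close>.\<close>

section \<open>The hypergeometric series: convergence, positivity, differential equation\<close>

definition hypergeo_coeff :: "real \<Rightarrow> real \<Rightarrow> real \<Rightarrow> nat \<Rightarrow> real" where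
  "hypergeo_coeff a b c n = pochhammer a n * pochhammer b n / (pochhammer c n * fact n)"

lemma hypergeo_2F1_eq_powser: "hypergeo_2F1 a b c x = (\<Sum>n. hypergeo_coeff a b c n * x ^ n)"
  by (simp add: hypergeo_2F1_def hypergeo_coeff_def)

lemma hypergeo_2F1_0 [simp]: "hypergeo_2F1 a b c (0::real) = 1"
  using powser_zero[of "hypergeo_coeff a b c"]
  by (simp add: hypergeo_2F1_eq_powser hypergeo_coeff_def)

text \<open>If \<open>c + real n = 0\<close>, both sides are 0 by the convention for division by
  zero, so the recurrence holds for every \<open>c\<close>.\<close>

lemma hypergeo_coeff_Suc:
  "hypergeo_coeff a b c (Suc n) =
     hypergeo_coeff a b c n * ((a + real n) * (b + real n) / ((c + real n) * real (Suc n)))"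
  by (simp add: hypergeo_coeff_def pochhammer_Suc mult_ac)

text \<open>Ratio test: the quotient of consecutive coefficients tends to 1.\<close>

lemma summable_hypergeo_coeff:
  assumes "\<bar>x\<bar> < 1"
  shows "summable (\<lambda>n. hypergeo_coeff a b c n * x ^ n)"
proof -
  obtain r where r: "\<bar>x\<bar> < r" "r < 1"
    using assms dense by blast
  let ?q = "\<lambda>n. (a + real n) * (b + real n) / ((c + real n) * real (Suc n))"
  have "?q \<longlonglongrightarrow> 1"
    by real_asymp
  then have "(\<lambda>n. \<bar>?q n * x\<bar>) \<longlonglongrightarrow> \<bar>1 * x\<bar>"
    by (intro tendsto_intros)
  then have "\<forall>\<^sub>F n in sequentially. \<bar>?q n * x\<bar> < r"
    using r by (intro order_tendstoD(2)[where y = "\<bar>1 * x\<bar>"]) auto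
  then obtain N where N: "\<And>n. n \<ge> N \<Longrightarrow> \<bar>?q n * x\<bar> < r"
    by (auto simp: eventually_sequentially)
  show ?thesis
  proof (rule summable_ratio_test[OF r(2)])
    fix n assume "N \<le> n"
    have "norm (hypergeo_coeff a b c (Suc n) * x ^ Suc n) =
            \<bar>?q n * x\<bar> * norm (hypergeo_coeff a b c n * x ^ n)"
      unfolding hypergeo_coeff_Suc real_norm_def abs_mult[symmetric] power_Suc by (simp only: mult_ac)
    also have "\<dots> \<le> r * norm (hypergeo_coeff a b c n * x ^ n)"
      using N[OF \<open>N \<le> n\<close>] by (intro mult_right_mono) auto
    finally show "norm (hypergeo_coeff a b c (Suc n) * x ^ Suc n)
        \<le> r * norm (hypergeo_coeff a b c n * x ^ n)" .
  qed
qed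

text \<open>All terms are nonnegative and the constant term is 1. This makes division by a solution
  legitimate later.\<close>

lemma hypergeo_2F1_pos:
  assumes "a > 0" "b > 0" "c > 0" "0 \<le> x" "x < (1::real)"
  shows "hypergeo_2F1 a b c x > 0"
proof -
  have nonneg: "0 \<le> hypergeo_coeff a b c n * x ^ n" for n
    using assms by (auto simp: hypergeo_coeff_def intro!: mult_nonneg_nonneg divide_nonneg_nonneg
        pochhammer_nonneg)
  show ?thesis
    unfolding hypergeo_2F1_eq_powser
    by (rule suminf_pos2[OF summable_hypergeo_coeff nonneg, where i = 0])
       (use assms in \<open>auto simp: hypergeo_coeff_def\<close>)
qed

text \<open>Termwise differentiation turns the equation into the two-term recurrence of the
  coefficients; the assumption on \<open>c\<close> allows its denominator to be cleared.\<close>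

lemma hypergeo_2F1_ode:
  fixes a b c :: real
  assumes c: "\<And>n. c + real n \<noteq> 0"
  obtains F' F'' where
    "\<And>x. \<bar>x\<bar> < 1 \<Longrightarrow> (hypergeo_2F1 a b c has_real_derivative F' x) (at x)"
    "\<And>x. \<bar>x\<bar> < 1 \<Longrightarrow> (F' has_real_derivative F'' x) (at x)"
    "\<And>x. \<bar>x\<bar> < 1 \<Longrightarrow>
       x * (1 - x) * F'' x + (c - (a + b + 1) * x) * F' x = a * b * hypergeo_2F1 a b c x"
proof -
  define A where "A = hypergeo_coeff a b c"
  define F' where "F' = (\<lambda>x. \<Sum>n. diffs A n * x ^ n)"
  define F'' where "F'' = (\<lambda>x. \<Sum>n. diffs (diffs A) n * x ^ n)"
  have F: "hypergeo_2F1 a b c = (\<lambda>x. \<Sum>n. A n * x ^ n)"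
    by (simp add: fun_eq_iff A_def hypergeo_2F1_eq_powser)
  have s0: "summable (\<lambda>n. A n * x ^ n)" if "\<bar>x\<bar> < 1" for x
    using summable_hypergeo_coeff[OF that] by (simp add: A_def)
  have s1: "summable (\<lambda>n. diffs A n * x ^ n)" if "\<bar>x\<bar> < 1" for x
    by (rule termdiff_converges[where K = 1]) (use that s0 in auto)
  have s2: "summable (\<lambda>n. diffs (diffs A) n * x ^ n)" if "\<bar>x\<bar> < 1" for x
    by (rule termdiff_converges[where K = 1]) (use that s1 in auto)
  show ?thesis
  proof (rule that)
    fix x :: real assume x: "\<bar>x\<bar> < 1"
    show "(hypergeo_2F1 a b c has_real_derivative F' x) (at x)"
      unfolding F F'_def by (rule termdiffs_strong'[where K = 1]) (use x s0 in auto)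
    show "(F' has_real_derivative F'' x) (at x)"
      unfolding F'_def F''_def by (rule termdiffs_strong'[where K = 1]) (use x s1 in auto)
    have F'_sums: "(\<lambda>n. diffs A n * x ^ n) sums F' x"
      unfolding F'_def by (rule summable_sums[OF s1[OF x]])
    have F_sums: "(\<lambda>n. A n * x ^ n) sums hypergeo_2F1 a b c x"
      unfolding F by (rule summable_sums[OF s0[OF x]])
    have xF'_sums: "(\<lambda>n. real n * A n * x ^ n) sums (x * F' x)"
    proof -
      \<comment> \<open>The truncated exponent at \<open>n = 0\<close> is harmless, as the factor
        \<open>real n\<close> vanishes there.\<close>
      have "(\<lambda>n. x * (real n * A n * x ^ (n - Suc 0))) sums (x * F' x)"
        unfolding F'_def by (intro sums_mult diffs_equiv s1 x)
      also have "(\<lambda>n. x * (real n * A n * x ^ (n - Suc 0))) = (\<lambda>n. real n * A n * x ^ n)"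
      proof
        show "x * (real n * A n * x ^ (n - Suc 0)) = real n * A n * x ^ n" for n
          by (cases n) auto
      qed
      finally show ?thesis .
    qed
    have xF''_sums: "(\<lambda>n. real n * diffs A n * x ^ n) sums (x * F'' x)"
    proof -
      have "(\<lambda>n. x * (real n * diffs A n * x ^ (n - Suc 0))) sums (x * F'' x)"
        unfolding F''_def by (intro sums_mult diffs_equiv s2 x)
      also have "(\<lambda>n. x * (real n * diffs A n * x ^ (n - Suc 0))) = (\<lambda>n. real n * diffs A n * x ^ n)"
      proof
        show "x * (real n * diffs A n * x ^ (n - Suc 0)) = real n * diffs A n * x ^ n" for n
          by (cases n) auto
      qed
      finally show ?thesis .
    qed
    have xxF''_sums: "(\<lambda>n. real n * (real n - 1) * A n * x ^ n) sums (x * (x * F'' x))"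
    proof -
      \<comment> \<open>The shift back from \<open>Suc n\<close> to \<open>n\<close> loses nothing,
        since the target series has zero term at \<open>n = 0\<close>.\<close>
      have "(\<lambda>n. real (Suc n) * real n * A (Suc n) * x ^ Suc n) sums (x * (x * F'' x))"
        using sums_mult[OF xF''_sums, of x] by (simp add: diffs_def mult_ac)
      then show ?thesis
        using sums_Suc_iff[of "\<lambda>n. real n * (real n - 1) * A n * x ^ n"] by simp
    qed
    have rec: "(c + real n) * real (Suc n) * A (Suc n) = (a + real n) * (b + real n) * A n" for n
      using c[of n] by (simp add: A_def hypergeo_coeff_Suc del: of_nat_Suc)
    \<comment> \<open>The \<open>diffs\<close> terms add up to the left side of \<open>rec\<close>;
      the others match its right side because
      \<open>n * (n - 1) + (a + b + 1) * n + a * b = (a + n) * (b + n)\<close>.\<close>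
    have "real n * diffs A n * x ^ n - real n * (real n - 1) * A n * x ^ n + c * (diffs A n * x ^ n)
            - (a + b + 1) * (real n * A n * x ^ n) = a * b * (A n * x ^ n)" for n
      using arg_cong[OF rec[of n], of "\<lambda>t. t * x ^ n"] by (simp add: diffs_def algebra_simps)
    then have "(\<lambda>n. a * b * (A n * x ^ n)) sums
        (x * F'' x - x * (x * F'' x) + c * F' x - (a + b + 1) * (x * F' x))"
      using sums_diff[OF sums_add[OF sums_diff[OF xF''_sums xxF''_sums] sums_mult[OF F'_sums]]
          sums_mult[OF xF'_sums], of c "a + b + 1"] by simp
    from sums_unique2[OF this sums_mult[OF F_sums, of "a * b"]]
    show "x * (1 - x) * F'' x + (c - (a + b + 1) * x) * F' x = a * b * hypergeo_2F1 a b c x"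
      by (simp add: algebra_simps)
  qed
qed

section \<open>Uniqueness up to a factor at a singular endpoint\<close>

text \<open>Continuity of \<open>p * f'\<close> and \<open>p * g'\<close> at \<open>r\<close>, where
  \<open>p\<close> vanishes, is a boundary condition that replaces a second initial value; at a
  simple zero of \<open>p\<close> it excludes logarithmic solutions.\<close>

lemma sturm_liouville_singular_endpoint:
  fixes f g f' g' p q :: "real \<Rightarrow> real"
  assumes cont: "continuous_on {l<..r} f" "continuous_on {l<..r} g"
      "continuous_on {l<..r} (\<lambda>x. p x * f' x)" "continuous_on {l<..r} (\<lambda>x. p x * g' x)"
    and f: "\<And>x. x \<in> {l<..<r} \<Longrightarrow> (f has_real_derivative f' x) (at x)"
      "\<And>x. x \<in> {l<..<r} \<Longrightarrow> ((\<lambda>x. p x * f' x) has_real_derivative q x * f x) (at x)"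
    and g: "\<And>x. x \<in> {l<..<r} \<Longrightarrow> (g has_real_derivative g' x) (at x)"
      "\<And>x. x \<in> {l<..<r} \<Longrightarrow> ((\<lambda>x. p x * g' x) has_real_derivative q x * g x) (at x)"
    and p: "\<And>x. x \<in> {l<..<r} \<Longrightarrow> p x \<noteq> 0" "p r = 0"
    and nz: "\<And>x. x \<in> {l<..r} \<Longrightarrow> f x \<noteq> 0"
    and x: "x \<in> {l<..r}"
  shows "g x / f x = g r / f r"
proof -
  have const: "h x = h r" if "x \<in> {l<..<r}" "continuous_on {l<..r} h"
    "\<And>y. y \<in> {l<..<r} \<Longrightarrow> (h has_real_derivative 0) (at y)" for x and h :: "real \<Rightarrow> real"
    using DERIV_isconst2[of x r h r] that continuous_on_subset[of "{l<..r}" h "{x..r}"] by force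
  let ?w = "\<lambda>x. f x * (p x * g' x) - g x * (p x * f' x)"
  \<comment> \<open>The terms \<open>q * f * g\<close> cancel, and so do the terms
    \<open>p * f' * g'\<close>.\<close>
  have "(?w has_real_derivative 0) (at y)" if "y \<in> {l<..<r}" for y
    by (rule derivative_eq_intros f[OF that] g[OF that] refl)+ (simp add: algebra_simps)
  then have w: "?w y = ?w r" if "y \<in> {l<..<r}" for y
    using that by (intro const continuous_intros cont)
  have "((\<lambda>x. g x / f x) has_real_derivative 0) (at y)" if y: "y \<in> {l<..<r}" for y
  proof -
    have "p y * (f y * g' y - g y * f' y) = 0"
      using w[OF y] p(2) by (simp add: algebra_simps)
    then have "g' y * f y - g y * f' y = 0"
      using p(1)[OF y] by (simp add: mult.commute)
    then show ?thesis
      using DERIV_divide[OF g(1)[OF y] f(1)[OF y]] nz[of y] y by simp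
  qed
  then show ?thesis
    using const[of x "\<lambda>x. g x / f x"] x nz
    by (cases "x = r") (force intro!: continuous_intros cont)+
qed

section \<open>The cubic transformation\<close>

theorem lemma3p1:
  fixes k :: real
  assumes "0 < k" and "k \<le> 1"
  shows "hypergeo_2F1 (1/3) (2/3) 1 (1 - k ^ 3) =
         3 / (1 + 2 * k) * hypergeo_2F1 (1/3) (2/3) 1 (((1 - k) / (1 + 2 * k)) ^ 3)"
proof -
  define F :: "real \<Rightarrow> real" where "F = hypergeo_2F1 (1/3) (2/3) 1"
  obtain F' F'' where F': "\<And>x. \<bar>x\<bar> < 1 \<Longrightarrow> (F has_real_derivative F' x) (at x)"
    and F'': "\<And>x. \<bar>x\<bar> < 1 \<Longrightarrow> (F' has_real_derivative F'' x) (at x)"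
    and ode: "\<And>x. \<bar>x\<bar> < 1 \<Longrightarrow> x * (1 - x) * F'' x + (1 - 2 * x) * F' x = 2 / 9 * F x"
  proof (rule hypergeo_2F1_ode[of 1 "1/3" "2/3"])
    show "1 + real n \<noteq> 0" for n by linarith
  qed (auto simp: F_def)
  \<comment> \<open>For these parameters the equation is self-adjoint: \<open>Q' = 2/9 * F\<close>.
    Working with \<open>Q\<close> keeps \<open>F''\<close> out of all later computations.\<close>
  define Q where "Q = (\<lambda>x. x * (1 - x) * F' x)"
  have Q: "(Q has_real_derivative 2 / 9 * F x) (at x)" if "\<bar>x\<bar> < 1" for x
  proof -
    have "(Q has_real_derivative x * (1 - x) * F'' x + (1 - 2 * x) * F' x) (at x)"
      unfolding Q_def by (rule derivative_eq_intros F''[OF that] refl)+ (simp add: algebra_simps)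
    then show ?thesis by (simp add: ode[OF that])
  qed
  \<comment> \<open>The derivative is a free \<open>D\<close> with its own equation, so that the
    rule can be applied whatever form the goal has.\<close>
  have F_chain: "((\<lambda>t. F (g t)) has_real_derivative D) (at t)"
    if "\<bar>g t\<bar> < 1" "(g has_real_derivative g') (at t)" "F' (g t) * g' = D" for g g' D t
    using DERIV_chain2[OF F' that(2)] that by blast
  have Q_chain: "((\<lambda>t. Q (g t)) has_real_derivative D) (at t)"
    if "\<bar>g t\<bar> < 1" "(g has_real_derivative g') (at t)" "2 / 9 * F (g t) * g' = D" for g g' D t
    using DERIV_chain2[OF Q that(2)] that by blast
  define u where "u = (\<lambda>k::real. ((1 - k) / (1 + 2 * k)) ^ 3)"
  \<comment> \<open>With \<open>x = 1 - k ^ 3\<close>, this weight makes \<open>p * G'\<close> equal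
    to \<open>-3 * Q x\<close>.\<close>
  define p where "p = (\<lambda>k::real. k * (1 - k ^ 3))"
  define G where "G = (\<lambda>k. F (1 - k ^ 3))"
  define H where "H = (\<lambda>k. 3 / (1 + 2 * k) * F (u k))"
  define u' where "u' = (\<lambda>k::real. - 9 * (1 - k)\<^sup>2 / (1 + 2 * k) ^ 4)"
  define G' where "G' = (\<lambda>k. - 3 * k\<^sup>2 * F' (1 - k ^ 3))"
  define H' where "H' = (\<lambda>k. - 6 / (1 + 2 * k)\<^sup>2 * F (u k) + 3 / (1 + 2 * k) * u' k * F' (u k))"
  have x_bound: "\<bar>1 - t ^ 3\<bar> < 1" if "t \<in> {0<..1}" for t :: real
    using that power_le_one[of t 3] by (auto simp: abs_if)
  have u_bound: "0 \<le> u t" "u t < 1" if "t \<in> {0<..1}" for t :: real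
    using that by (auto simp: u_def power_less_one_iff)
  have u_abs: "\<bar>u t\<bar> < 1" if "t \<in> {0<..1}" for t
    using u_bound[OF that] by simp
  have u': "(u has_real_derivative u' t) (at t)" if "t \<in> {0<..1}" for t
    unfolding u_def u'_def using that
    by (auto intro!: derivative_eq_intros simp: divide_simps) algebra
  have pG': "p t * G' t = - 3 * Q (1 - t ^ 3)" for t
    by (simp add: p_def G'_def Q_def power3_eq_cube power2_eq_square)
  \<comment> \<open>This rests on
    \<open>(1 + 2 * t) ^ 3 - (1 - t) ^ 3 = 9 * t * (1 + t + t\<^sup>2)\<close>, whose product with
    \<open>1 - t\<close> is \<open>9 * p t\<close>.\<close>
  have u_1_u: "(1 + 2 * t) ^ 6 * (u t * (1 - u t)) = 9 * (1 - t)\<^sup>2 * p t" if "t \<in> {0<..}" for t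
    using that by (simp add: u_def p_def power_divide divide_simps) algebra
  have Qu: "p t * u' t * F' (u t) = - (1 + 2 * t)\<^sup>2 * Q (u t)" if "t \<in> {0<..}" for t
  proof -
    have v: "1 + 2 * t \<noteq> 0" using that by auto
    have "(1 + 2 * t) ^ 4 * (p t * u' t) = - ((1 + 2 * t) ^ 6 * (u t * (1 - u t)))"
      using v unfolding u_1_u[OF that] by (simp add: u'_def)
    also have "\<dots> = (1 + 2 * t) ^ 4 * (- (1 + 2 * t)\<^sup>2 * (u t * (1 - u t)))"
      by algebra
    finally have "p t * u' t = - (1 + 2 * t)\<^sup>2 * (u t * (1 - u t))"
      using v unfolding mult_cancel_left by simp
    then show ?thesis by (simp add: Q_def)
  qed
  \<comment> \<open>Eliminates \<open>F'\<close> in favour of \<open>Q\<close>, whose derivative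
    involves only \<open>F\<close>.\<close>
  have pH': "p t * H' t = - 6 * p t / (1 + 2 * t)\<^sup>2 * F (u t) - 3 * (1 + 2 * t) * Q (u t)"
    if "t \<in> {0<..}" for t
  proof -
    have "p t * H' t = - 6 * p t / (1 + 2 * t)\<^sup>2 * F (u t) + 3 / (1 + 2 * t) * (p t * u' t * F' (u t))"
      by (simp add: H'_def algebra_simps)
    also have "3 / (1 + 2 * t) * (p t * u' t * F' (u t)) = - 3 * (1 + 2 * t) * Q (u t)"
      using that unfolding Qu[OF that] by (simp add: divide_simps) algebra
    finally show ?thesis by (simp add: algebra_simps)
  qed
  have G_deriv: "(G has_real_derivative G' t) (at t)" if "t \<in> {0<..1}" for t
    unfolding G_def G'_def
    by (rule derivative_eq_intros F_chain x_bound that refl)+ simp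
  have dFu: "((\<lambda>t. F (u t)) has_real_derivative F' (u t) * u' t) (at t)"
    and dQu: "((\<lambda>t. Q (u t)) has_real_derivative 2 / 9 * F (u t) * u' t) (at t)"
    if "t \<in> {0<..1}" for t
    by (rule F_chain Q_chain u_abs u' that refl)+
  have H_deriv: "(H has_real_derivative H' t) (at t)" if t: "t \<in> {0<..1}" for t
  proof -
    have "((\<lambda>t. 3 / (1 + 2 * t)) has_real_derivative - 6 / (1 + 2 * t)\<^sup>2) (at t)"
      using t by (auto intro!: derivative_eq_intros simp: power2_eq_square)
    from DERIV_mult[OF this dFu[OF t]] show ?thesis
      by (simp add: H_def H'_def mult_ac)
  qed
  have pG'_deriv: "((\<lambda>t. p t * G' t) has_real_derivative 2 * t\<^sup>2 * G t) (at t)"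
    if "t \<in> {0<..1}" for t
    unfolding pG' G_def
    by (rule derivative_eq_intros Q_chain x_bound that refl)+ simp
  have pH'_deriv: "((\<lambda>t. p t * H' t) has_real_derivative 2 * t\<^sup>2 * H t) (at t)"
    if t: "t \<in> {0<..1}" for t
  proof -
    have t0: "t \<in> {0<..}" and v: "1 + 2 * t \<noteq> 0" using t by auto
    \<comment> \<open>The polynomial is \<open>(1 + 2 * t) * p' - 4 * p\<close> at \<open>t\<close>,
      with \<open>p' = 1 - 4 * t ^ 3\<close>.\<close>
    have r': "((\<lambda>t. - 6 * p t / (1 + 2 * t)\<^sup>2) has_real_derivative
        - 6 * (1 - 2 * t - 4 * t ^ 3 - 4 * t ^ 4) / (1 + 2 * t) ^ 3) (at t)"
      unfolding p_def using v by (auto intro!: derivative_eq_intros simp: divide_simps) algebra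
    have "((\<lambda>t. - 6 * p t / (1 + 2 * t)\<^sup>2 * F (u t) - 3 * (1 + 2 * t) * Q (u t)) has_real_derivative
        - 6 * (1 - 2 * t - 4 * t ^ 3 - 4 * t ^ 4) / (1 + 2 * t) ^ 3 * F (u t)
        - 6 / (1 + 2 * t)\<^sup>2 * (p t * u' t * F' (u t))
        - 6 * Q (u t) - 2 / 3 * (1 + 2 * t) * u' t * F (u t)) (at t)"
    proof -
      have l': "((\<lambda>t. 3 * (1 + 2 * t)) has_real_derivative 6) (at t)"
        by (auto intro!: derivative_eq_intros)
      show ?thesis
        by (rule DERIV_cong[OF DERIV_diff[OF DERIV_mult[OF r' dFu[OF t]] DERIV_mult[OF l' dQu[OF t]]]])
           (simp add: algebra_simps add_divide_distrib)
    qed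
    \<comment> \<open>The \<open>F'\<close> term from the first product thus cancels the
      \<open>Q\<close> term from the second, leaving a multiple of \<open>F (u t)\<close>.\<close>
    also have "6 / (1 + 2 * t)\<^sup>2 * (p t * u' t * F' (u t)) = - 6 * Q (u t)"
      using v unfolding Qu[OF t0] by simp
    also have "- 6 * (1 - 2 * t - 4 * t ^ 3 - 4 * t ^ 4) / (1 + 2 * t) ^ 3 * F (u t) - - 6 * Q (u t)
        - 6 * Q (u t) - 2 / 3 * (1 + 2 * t) * u' t * F (u t) = 2 * t\<^sup>2 * H t"
    proof -
      have c: "2 / 3 * (1 + 2 * t) * u' t = - 6 * (1 - t)\<^sup>2 / (1 + 2 * t) ^ 3"
        using v by (simp add: u'_def divide_simps power_numeral_reduce)
      \<comment> \<open>The remaining numerator contains the square of \<open>1 + 2 * t\<close>,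
        which reduces the factor of \<open>F (u t)\<close> to \<open>2 * t\<^sup>2\<close> times the
        prefactor of \<open>H\<close>.\<close>
      have "- 6 * (1 - 2 * t - 4 * t ^ 3 - 4 * t ^ 4) + 6 * (1 - t)\<^sup>2 = 6 * t\<^sup>2 * (1 + 2 * t)\<^sup>2"
        by algebra
      then have "- 6 * (1 - 2 * t - 4 * t ^ 3 - 4 * t ^ 4) / (1 + 2 * t) ^ 3
          - 2 / 3 * (1 + 2 * t) * u' t = 6 * t\<^sup>2 * (1 + 2 * t)\<^sup>2 / (1 + 2 * t) ^ 3"
        unfolding c by (simp flip: add_divide_distrib)
      also have "\<dots> = 6 * t\<^sup>2 / (1 + 2 * t)"
        using v by (simp add: power2_eq_square power3_eq_cube)
      finally have "(- 6 * (1 - 2 * t - 4 * t ^ 3 - 4 * t ^ 4) / (1 + 2 * t) ^ 3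
          - 2 / 3 * (1 + 2 * t) * u' t) * F (u t) = 6 * t\<^sup>2 / (1 + 2 * t) * F (u t)"
        by (rule arg_cong)
      then show ?thesis
        unfolding H_def left_diff_distrib by simp
    qed
    finally show ?thesis
      \<comment> \<open>An identity on an open set around \<open>t\<close> is required, also for
        \<open>t = 1\<close>; hence \<open>pH'\<close> is stated on the whole half-line.\<close>
      by (rule has_field_derivative_transform_within_open[OF _ open_greaterThan t0])
         (simp add: pH')
  qed
  \<comment> \<open>The endpoint 1 is included: both arguments of \<open>F\<close> are 0 there,
    inside the disc of convergence, so two-sided derivatives exist.\<close>
  have cont: "continuous_on {0<..1} f"
    if "\<And>t. t \<in> {0<..1} \<Longrightarrow> (f has_real_derivative f' t) (at t)" for f f' :: "real \<Rightarrow> real"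
    using that by (blast intro: continuous_at_imp_continuous_on DERIV_isCont)
  have "H k / G k = H 1 / G 1"
  proof (rule sturm_liouville_singular_endpoint[where l = 0 and p = p and q = "\<lambda>t. 2 * t\<^sup>2"
        and f' = G' and g' = H'])
    show "continuous_on {0<..1} G" "continuous_on {0<..1} H"
      "continuous_on {0<..1} (\<lambda>t. p t * G' t)" "continuous_on {0<..1} (\<lambda>t. p t * H' t)"
      by (rule cont, erule G_deriv H_deriv pG'_deriv pH'_deriv)+
    show "p 1 = 0" "k \<in> {0<..1}" using assms by (auto simp: p_def)
    show "p t \<noteq> 0" if "t \<in> {0<..<1}" for t
      using that power_less_one_iff[of t 3] by (auto simp: p_def)
    show "G t \<noteq> 0" if "t \<in> {0<..1}" for t
      using hypergeo_2F1_pos[of "1/3" "2/3" 1 "1 - t ^ 3"] that power_le_one[of t 3]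
      by (auto simp: G_def F_def)
  qed (auto intro!: G_deriv H_deriv pG'_deriv pH'_deriv)
  moreover have "H 1 = 1" "G 1 = 1"
    by (simp_all add: H_def G_def F_def u_def)
  ultimately have "G k = H k"
    by auto
  then show ?thesis
    by (simp only: H_def G_def F_def u_def)
qed

end
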